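(* Consider the MI-NEP of the context. Suppose that Assumption A (with constants $\alpha\in[0,1)$ and $\mathbf w\in\mathbb R^N$, $w_\nu>0$) and Assumption B (with constant $\beta>0$) hold, and that $\max_{\nu\in\mathcal I}\sqrt{i_\nu}>0$. Let $\{\mathbf x^k\}_{k\in\mathbb N}\subseteq\Omega$ be a sequence generated by the Jacobi-type best-response method with index sets $\{\mathcal J^k\}_{k\in\mathbb N}$, and assume that there is an integer $h\ge 1$ such that every $h$ iterations at least one best response of any player is computed, that is, $\nu\in\bigcup_{t=k}^{k+h-1}\mathcal J^t$ for every player $\nu\in\mathcal I$ and every iteration $k$. Let $\mathcal S$ be the (possibly empty) set of equilibria of the MI-NEP. (i) For every $\gamma\in(1,1/\alpha)$ and every $\mathbf x^*\in\mathcal S$, the method generates a point $\mathbf x^k$ such that $$\max_{\nu\in\mathcal I} w_\nu\|x^{k,\nu}-x^{*,\nu}\| < 2\beta\left(\frac{\gamma}{1-\gamma\alpha}\right)\max_{\nu\in\mathcal I}w_\nu\sqrt{i_\nu}\qquad(\star)$$ after at most $\overline k_\gamma$ iterations, where $$\overline k_\gamma := h\left\lceil \log_\gamma\left(\max\left\{\frac{(1-\gamma\alpha)\max_{\mathbf z^*\in\mathcal S,\,\nu\in\mathcal I}w_\nu\|x^{0,\nu}-z^{*,\nu}\|}{2\beta\max_{\nu\in\mathcal I}w_\nu\sqrt{i_\nu}},\ \gamma\right\}\right)\right\rceil .$$ (ii) For every $\gamma\in(1,1/\alpha)$ and every $\mathbf x^*\in\mathcal S$, any point $\mathbf x^k$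 with $k\ge\overline k_\gamma$ satisfies $(\star)$. (iii) Assume that $\Omega$ is bounded or $\mathcal S$ is nonempty. Then $\{\mathbf x^k\}_{k\in\mathbb N}$ has at least one cluster point, and every cluster point $\widetilde{\mathbf x}$ is contained in $\Omega$ and satisfies, for every $\mathbf x^*\in\mathcal S$, $$\max_{\nu\in\mathcal I}w_\nu\|\widetilde x^\nu-x^{*,\nu}\|\le 2\beta\left(\frac{1}{1-\alpha}\right)\max_{\nu\in\mathcal I}w_\nu\sqrt{i_\nu}.$$
   Context: MI-NEP (mixed-integer Nash equilibrium problem). There are $N$ players, $\mathcal I=\{1,\dots,N\}$. Player $\nu$ controls $x^\nu\in\mathbb R^{n_\nu}$; $\mathbf x=(x^\nu)_{\nu\in\mathcal I}\in\mathbb R^n$, $n=\sum_\nu n_\nu$; $\mathbf x^{-\nu}$ collects the strategies of all players other than $\nu$, and one writes $\mathbf x=(x^\nu,\mathbf x^{-\nu})$. Given $\mathbf x^{-\nu}$, player $\nu$ solves $$\min_{x^\nu}\ \theta_\nu(x^\nu,\mathbf x^{-\nu})\quad\text{s.t. } x^\nu\in\Omega_\nu:=\{x^\nu\in X_\nu \mid x^\nu_j\in\mathbb Z,\ j=1,\dots,i_\nu\},$$ where $\theta_\nu:\mathbb R^n\to\mathbb R$ is continuously differentiable and convex with respect to $x^\nu$, $X_\nu\subseteq\mathbb R^{n_\nu}$ is closed and convex (possibly unbounded), $0\le i_\nu\le n_\nu$ is an integer, and $\Omega_\nu\neq\emptyset$. Put $\Omega=\prod_\nu\Omega_\nu$,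 $X=\prod_\nu X_\nu$, $\Omega_{-\nu}=\prod_{\nu'\ne\nu}\Omega_{\nu'}$. Standing assumption: each player's problem has a solution for every given $\mathbf x^{-\nu}$. Best responses: $R_\nu(\mathbf x^{-\nu})=\arg\min\{\theta_\nu(x^\nu,\mathbf x^{-\nu}) : x^\nu\in\Omega_\nu\}$ (mixed-integer) and $T_\nu(\mathbf x^{-\nu})=\arg\min\{\theta_\nu(x^\nu,\mathbf x^{-\nu}) : x^\nu\in X_\nu\}$ (continuous). It is assumed throughout that $T=(T_\nu)_\nu$ is single-valued on $X$. Equilibrium of the MI-NEP: $\overline{\mathbf x}\in\Omega$ such that $\overline x^\nu\in R_\nu(\overline{\mathbf x}^{-\nu})$ for all $\nu\in\mathcal I$. $\|\cdot\|$ is any given norm. Assumption A: there exist $\alpha\in[0,1)$ and $\mathbf w\in\mathbb R^N$ with $w_\nu>0$ for all $\nu$ such that for all $\mathbf z,\mathbf y\in X$: $\max_{\nu}w_\nu\|T_\nu(\mathbf z^{-\nu})-T_\nu(\mathbf y^{-\nu})\|\le\alpha\max_\nu w_\nu\|z^\nu-y^\nu\|$. Assumption B: there exists $\beta>0$ such that for all $\nu\in\mathcal I$ and $\mathbf z^{-\nu}\in\Omega_{-\nu}$: $\|\widehat x^\nu-T_\nu(\mathbf z^{-\nu})\|\le\beta\sqrt{i_\nu}$ for all $\widehat x^\nu\in R_\nu(\mathbf z^{-\nu})$. Jacobi-type best-response method: start from $\mathbf x^0\in\Omega$; at each iteration $k=0,1,\dots$ select a subset $\mathcal J^k\subseteq\mathcal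 I$; for $\nu\in\mathcal J^k$ choose any $x^{k+1,\nu}\in R_\nu(\mathbf x^{k,-\nu})$; for $\nu\notin\mathcal J^k$ set $x^{k+1,\nu}=x^{k,\nu}$. Convention: $1/\alpha=+\infty$ if $\alpha=0$. Items (i) and (ii) are vacuous when $\mathcal S=\emptyset$. *)

theory Defs
  imports "HOL-Analysis.Analysis"
begin

text \<open>
  A player set is a finite type \<open>'p\<close>. The joint space of all players' variables is
  \<open>real ^ 'n\<close>; every coordinate \<open>j :: 'n\<close> belongs to the player \<open>owner G j\<close> and is the
  \<open>pos G j\<close>-th component (counted from 1) of that player's vector. The players may thus have
  different numbers \<open>nvars G \<nu>\<close> of variables. The space of strategies of player \<open>\<nu>\<close> is
  rendered as the coordinate subspace of \<open>real ^ 'n\<close> of vectors supported on the coordinates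
  owned by \<open>\<nu>\<close>. The fields \<open>cost\<close> and \<open>feas\<close> are the objective functions and the convex
  sets containing the mixed-integer feasible sets.
\<close>

record ('p, 'n) minep =
  owner :: "'n \<Rightarrow> 'p"
  pos :: "'n \<Rightarrow> nat"
  nvars :: "'p \<Rightarrow> nat"
  nint :: "'p \<Rightarrow> nat"
  cost :: "'p \<Rightarrow> real ^ 'n \<Rightarrow> real"
  feas :: "'p \<Rightarrow> (real ^ 'n) set"

definition strategy_space :: "('p, 'n::finite) minep \<Rightarrow> 'p \<Rightarrow> (real ^ 'n) set" where
  "strategy_space G \<nu> = {v. \<forall>j. owner G j \<noteq> \<nu> \<longrightarrow> v $ j = 0}"

definition block :: "('p, 'n::finite) minep \<Rightarrow> 'p \<Rightarrow> real ^ 'n \<Rightarrow> real ^ 'n" where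
  "block G \<nu> x = (\<chi> j. if owner G j = \<nu> then x $ j else 0)"

text \<open>
  \<open>deviate G \<nu> y x\<close> is the profile in which \<open>\<nu>\<close> plays \<open>y\<close> and the others play as in \<open>x\<close>.
  It does not depend on the coordinates of \<open>x\<close> owned by \<open>\<nu>\<close>. The rivals' strategies are
  therefore always passed as a full profile whose block \<open>\<nu>\<close> is irrelevant.
\<close>

definition deviate :: "('p, 'n::finite) minep \<Rightarrow> 'p \<Rightarrow> real ^ 'n \<Rightarrow> real ^ 'n \<Rightarrow> real ^ 'n" where
  "deviate G \<nu> y x = (\<chi> j. if owner G j = \<nu> then y $ j else x $ j)"

definition mi_feas :: "('p, 'n::finite) minep \<Rightarrow> 'p \<Rightarrow> (real ^ 'n) set" where
  "mi_feas G \<nu> =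
     {y \<in> feas G \<nu>. \<forall>j. owner G j = \<nu> \<and> pos G j \<in> {1..nint G \<nu>} \<longrightarrow> y $ j \<in> \<int>}"

definition mi_profiles :: "('p, 'n::finite) minep \<Rightarrow> (real ^ 'n) set" where
  "mi_profiles G = {x. \<forall>\<nu>. block G \<nu> x \<in> mi_feas G \<nu>}"

definition profiles :: "('p, 'n::finite) minep \<Rightarrow> (real ^ 'n) set" where
  "profiles G = {x. \<forall>\<nu>. block G \<nu> x \<in> feas G \<nu>}"

definition mi_best_response :: "('p, 'n::finite) minep \<Rightarrow> 'p \<Rightarrow> real ^ 'n \<Rightarrow> (real ^ 'n) set" where
  "mi_best_response G \<nu> x =
     {y. is_arg_min (\<lambda>y. cost G \<nu> (deviate G \<nu> y x)) (\<lambda>y. y \<in> mi_feas G \<nu>) y}"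

definition cont_best_response :: "('p, 'n::finite) minep \<Rightarrow> 'p \<Rightarrow> real ^ 'n \<Rightarrow> (real ^ 'n) set" where
  "cont_best_response G \<nu> x =
     {y. is_arg_min (\<lambda>y. cost G \<nu> (deviate G \<nu> y x)) (\<lambda>y. y \<in> feas G \<nu>) y}"

definition equilibria :: "('p, 'n::finite) minep \<Rightarrow> (real ^ 'n) set" where
  "equilibria G = {x \<in> mi_profiles G. \<forall>\<nu>. block G \<nu> x \<in> mi_best_response G \<nu> x}"

definition is_minep :: "('p::finite, 'n::finite) minep \<Rightarrow> bool" where
  "is_minep G \<longleftrightarrow>
     (\<forall>\<nu>. bij_betw (pos G) {j. owner G j = \<nu>} {1..nvars G \<nu>}) \<and>
     (\<forall>\<nu>. nint G \<nu> \<le> nvars G \<nu>) \<and>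
     (\<forall>\<nu>. \<exists>g. continuous_on UNIV g \<and> (\<forall>x. GDERIV (cost G \<nu>) x :> g x)) \<and>
     (\<forall>\<nu> x. convex_on (strategy_space G \<nu>) (\<lambda>y. cost G \<nu> (deviate G \<nu> y x))) \<and>
     (\<forall>\<nu>. feas G \<nu> \<subseteq> strategy_space G \<nu> \<and> closed (feas G \<nu>) \<and> convex (feas G \<nu>)) \<and>
     (\<forall>\<nu>. mi_feas G \<nu> \<noteq> {}) \<and>
     (\<forall>\<nu> x. mi_best_response G \<nu> x \<noteq> {})"

definition cont_single_valued :: "('p, 'n::finite) minep \<Rightarrow> bool" where
  "cont_single_valued G \<longleftrightarrow>
     (\<forall>x \<in> profiles G. \<forall>\<nu>. is_singleton (cont_best_response G \<nu> x))"

definition cont_br :: "('p, 'n::finite) minep \<Rightarrow> 'p \<Rightarrow> real ^ 'n \<Rightarrow> real ^ 'n" where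
  "cont_br G \<nu> x = the_elem (cont_best_response G \<nu> x)"

definition norm_on :: "'a::real_vector set \<Rightarrow> ('a \<Rightarrow> real) \<Rightarrow> bool" where
  "norm_on V f \<longleftrightarrow>
     (\<forall>x\<in>V. 0 \<le> f x) \<and>
     (\<forall>x\<in>V. f x = 0 \<longleftrightarrow> x = 0) \<and>
     (\<forall>c. \<forall>x\<in>V. f (c *\<^sub>R x) = \<bar>c\<bar> * f x) \<and>
     (\<forall>x\<in>V. \<forall>y\<in>V. f (x + y) \<le> f x + f y)"

definition wdist ::
  "('p::finite, 'n::finite) minep \<Rightarrow> ('p \<Rightarrow> real ^ 'n \<Rightarrow> real) \<Rightarrow> ('p \<Rightarrow> real) \<Rightarrow>
    real ^ 'n \<Rightarrow> real ^ 'n \<Rightarrow> real" where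
  "wdist G nrm w x y = (MAX \<nu>. w \<nu> * nrm \<nu> (block G \<nu> x - block G \<nu> y))"

definition assumption_A ::
  "('p::finite, 'n::finite) minep \<Rightarrow> ('p \<Rightarrow> real ^ 'n \<Rightarrow> real) \<Rightarrow> real \<Rightarrow> ('p \<Rightarrow> real) \<Rightarrow> bool" where
  "assumption_A G nrm \<alpha> w \<longleftrightarrow>
     0 \<le> \<alpha> \<and> \<alpha> < 1 \<and> (\<forall>\<nu>. 0 < w \<nu>) \<and>
     (\<forall>z\<in>profiles G. \<forall>y\<in>profiles G.
        (MAX \<nu>. w \<nu> * nrm \<nu> (cont_br G \<nu> z - cont_br G \<nu> y)) \<le> \<alpha> * wdist G nrm w z y)"

definition assumption_B ::
  "('p, 'n::finite) minep \<Rightarrow> ('p \<Rightarrow> real ^ 'n \<Rightarrow> real) \<Rightarrow> real \<Rightarrow> bool" where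
  "assumption_B G nrm \<beta> \<longleftrightarrow>
     0 < \<beta> \<and>
     (\<forall>\<nu> z. (\<forall>\<nu>'. \<nu>' \<noteq> \<nu> \<longrightarrow> block G \<nu>' z \<in> mi_feas G \<nu>') \<longrightarrow>
        (\<forall>y\<in>mi_best_response G \<nu> z. nrm \<nu> (y - cont_br G \<nu> z) \<le> \<beta> * sqrt (real (nint G \<nu>))))"

definition jacobi_sequence ::
  "('p, 'n::finite) minep \<Rightarrow> (nat \<Rightarrow> 'p set) \<Rightarrow> (nat \<Rightarrow> real ^ 'n) \<Rightarrow> bool" where
  "jacobi_sequence G J x \<longleftrightarrow>
     x 0 \<in> mi_profiles G \<and>
     (\<forall>k. \<forall>\<nu>\<in>J k. block G \<nu> (x (Suc k)) \<in> mi_best_response G \<nu> (x k)) \<and>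
     (\<forall>k. \<forall>\<nu>. \<nu> \<notin> J k \<longrightarrow> block G \<nu> (x (Suc k)) = block G \<nu> (x k))"

definition wsqrt_int :: "('p::finite, 'n::finite) minep \<Rightarrow> ('p \<Rightarrow> real) \<Rightarrow> real" where
  "wsqrt_int G w = (MAX \<nu>. w \<nu> * sqrt (real (nint G \<nu>)))"

text \<open>
  The set of equilibria may be infinite, so the maximum over it is written with the operator
  \<open>GREATEST\<close> rather than with \<open>Max\<close>, which is meaningful only for finite sets.
\<close>

definition kbar ::
  "('p::finite, 'n::finite) minep \<Rightarrow> ('p \<Rightarrow> real ^ 'n \<Rightarrow> real) \<Rightarrow> real \<Rightarrow> ('p \<Rightarrow> real) \<Rightarrow> real \<Rightarrow>
    nat \<Rightarrow> real ^ 'n \<Rightarrow> real \<Rightarrow> int" where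
  "kbar G nrm \<alpha> w \<beta> h x0 \<gamma> =
     int h * \<lceil>log \<gamma> (max
       ((1 - \<gamma> * \<alpha>) *
          (GREATEST r. \<exists>z\<in>equilibria G. \<exists>\<nu>. r = w \<nu> * nrm \<nu> (block G \<nu> x0 - block G \<nu> z)) /
        (2 * \<beta> * wsqrt_int G w))
       \<gamma>)\<rceil>"

definition cluster_point :: "(nat \<Rightarrow> 'a::topological_space) \<Rightarrow> 'a \<Rightarrow> bool" where
  "cluster_point x l \<longleftrightarrow> (\<exists>r::nat \<Rightarrow> nat. strict_mono r \<and> (x \<circ> r) \<longlonglongrightarrow> l)"

end

theory Submission
  imports Defs
begin

text \<open>
  Put \<open>C = 2 * \<beta> * wsqrt_int G w\<close> and let \<open>xs\<close> be an equilibrium. Whenever a player updates,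
  passing through the continuous best responses to the current point and to \<open>xs\<close> costs at most
  \<open>C\<close> by Assumption B (applied twice), while Assumption A contracts the distance between these two
  responses. So the new weighted block distance to \<open>xs\<close> is at most \<open>\<alpha> * D + C\<close>, where \<open>D\<close>
  is the old distance. Once every player has updated, i.e. every \<open>h\<close> iterations, the distance has
  passed through the affine map \<open>D \<mapsto> \<alpha> * D + C\<close>. Majorising its iterates by
  \<open>max (D / \<gamma> ^ m) (C / (1 - \<gamma> * \<alpha>))\<close> gives the iteration bound, and by
  \<open>C / (1 - \<alpha>) + \<alpha> ^ m * D\<close> the bound at cluster points.
\<close>

section \<open>Norms on subspaces\<close>

lemma norm_onD:
  assumes "norm_on V f" "x \<in> V"
  shows norm_on_nonneg: "0 \<le> f x"
    and norm_on_eq_0_iff: "f x = 0 \<longleftrightarrow> x = 0"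
    and norm_on_scaleR: "f (c *\<^sub>R x) = \<bar>c\<bar> * f x"
    and norm_on_add: "y \<in> V \<Longrightarrow> f (x + y) \<le> f x + f y"
  using assms by (simp_all add: norm_on_def)

lemma norm_on_minus:
  assumes "norm_on V f" "x \<in> V"
  shows "f (- x) = f x"
  using norm_on_scaleR[OF assms, of "- 1"] by simp

lemma norm_on_diff_commute:
  assumes "norm_on V f" "subspace V" "x \<in> V" "y \<in> V"
  shows "f (x - y) = f (y - x)"
  using norm_on_minus[OF assms(1) subspace_diff[OF assms(2-4)]] by simp

lemma norm_on_triangle_diff:
  assumes "norm_on V f" "subspace V" "x \<in> V" "y \<in> V" "z \<in> V"
  shows "f (x - z) \<le> f (x - y) + f (y - z)"
  using norm_on_add[OF assms(1) subspace_diff[OF assms(2,3,4)] subspace_diff[OF assms(2,4,5)]]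
  by simp

lemma norm_on_sum_le:
  assumes f: "norm_on V f" and V: "subspace V" and "finite B" "\<And>b. b \<in> B \<Longrightarrow> g b \<in> V"
  shows "f (sum g B) \<le> (\<Sum>b\<in>B. f (g b))"
  using assms(3,4)
proof (induction B rule: finite_induct)
  case empty
  then show ?case using f subspace_0[OF V] by (auto simp: norm_on_def)
next
  case (insert b B)
  have "f (g b + sum g B) \<le> f (g b) + f (sum g B)"
    using insert.prems subspace_sum[OF V, of B g] by (intro norm_on_add[OF f]) auto
  also have "f (sum g B) \<le> (\<Sum>b\<in>B. f (g b))" using insert.IH insert.prems by simp
  finally show ?case using insert.hyps by simp
qed

text \<open>Expanding in an orthonormal basis of \<open>V\<close> and bounding each coefficient by
  Cauchy-Schwarz leaves the constant \<open>\<Sum>b\<in>B. f b\<close>. Since \<open>f\<close> is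
  arbitrary, its comparison with the Euclidean norm gives access to topology.\<close>

lemma norm_on_upper:
  fixes V :: "'a::euclidean_space set"
  assumes f: "norm_on V f" and V: "subspace V"
  obtains M where "M \<ge> 0" "\<And>x. x \<in> V \<Longrightarrow> f x \<le> M * norm x"
proof -
  obtain B where B: "B \<subseteq> V" "pairwise orthogonal B" "\<And>b. b \<in> B \<Longrightarrow> norm b = 1"
    "independent B" "span B = V"
    using orthonormal_basis_subspace[OF V] by metis
  have fin: "finite B" using B(4) independent_imp_finite by blast
  have nn: "0 \<le> f b" if "b \<in> B" for b using f B(1) that by (auto intro: norm_on_nonneg)
  have "f x \<le> (\<Sum>b\<in>B. f b) * norm x" if x: "x \<in> V" for x
  proof -
    have "f x = f (\<Sum>b\<in>B. (x \<bullet> b) *\<^sub>R b)"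
      using orthonormal_basis_expand[OF B(2) B(3) _ fin, of x] x B(5) by simp
    also have "\<dots> \<le> (\<Sum>b\<in>B. f ((x \<bullet> b) *\<^sub>R b))"
      using B(1) V by (intro norm_on_sum_le[OF f V fin]) (auto simp: subspace_scale)
    also have "\<dots> \<le> (\<Sum>b\<in>B. f b * norm x)"
    proof (rule sum_mono)
      fix b assume b: "b \<in> B"
      have "f ((x \<bullet> b) *\<^sub>R b) = \<bar>x \<bullet> b\<bar> * f b"
        using b B(1) by (intro norm_on_scaleR[OF f]) auto
      also have "\<dots> \<le> norm x * f b"
        using Cauchy_Schwarz_ineq2[of x b] B(3)[OF b] nn[OF b] by (intro mult_right_mono) auto
      finally show "f ((x \<bullet> b) *\<^sub>R b) \<le> f b * norm x" by (simp add: mult.commute)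
    qed
    finally show ?thesis by (simp add: sum_distrib_right)
  qed
  with that[of "\<Sum>b\<in>B. f b"] nn show ?thesis by (simp add: sum_nonneg)
qed

text \<open>The reverse triangle inequality turns the upper comparison constant into a Lipschitz
  constant.\<close>

lemma continuous_on_norm_on:
  fixes V :: "'a::euclidean_space set"
  assumes f: "norm_on V f" and V: "subspace V"
  shows "continuous_on V f"
proof -
  obtain M where M: "M \<ge> 0" "\<And>x. x \<in> V \<Longrightarrow> f x \<le> M * norm x"
    using norm_on_upper[OF assms] by blast
  have "M-lipschitz_on V f"
  proof (rule lipschitz_onI)
    fix x y assume xy: "x \<in> V" "y \<in> V"
    have "f x \<le> f (x - y) + f y" "f y \<le> f (y - x) + f x"
      using norm_on_triangle_diff[OF assms _ _ subspace_0[OF V], of x y]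
        norm_on_triangle_diff[OF assms _ _ subspace_0[OF V], of y x] xy by simp_all
    then show "dist (f x) (f y) \<le> M * dist x y"
      using M(2)[OF subspace_diff[OF V xy]] norm_on_diff_commute[OF assms xy]
      by (simp add: dist_real_def dist_norm)
  qed (rule M(1))
  then show ?thesis by (rule lipschitz_on_continuous_on)
qed

text \<open>On the compact unit sphere of \<open>V\<close> the continuous \<open>f\<close> attains a
  positive minimum; homogeneity extends the bound to all of \<open>V\<close>.\<close>

lemma norm_on_lower:
  fixes V :: "'a::euclidean_space set"
  assumes f: "norm_on V f" and V: "subspace V"
  obtains m where "m \<ge> 0" "\<And>x. x \<in> V \<Longrightarrow> norm x \<le> m * f x"
\<comment> \<open>The unit sphere of the zero subspace is empty, so no minimum exists there.\<close>
proof (cases "V \<subseteq> {0}")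
  case True
  then show ?thesis using f by (intro that[of 0]) (auto simp: norm_on_def)
next
  case False
  then obtain v where v: "v \<in> V" "v \<noteq> 0" by blast
  let ?S = "sphere 0 1 \<inter> V"
  have "compact ?S" using closed_subspace[OF V] by (intro compact_Int_closed) auto
  moreover have "v /\<^sub>R norm v \<in> ?S" using v V by (simp add: subspace_scale)
  moreover have "continuous_on ?S f"
    using continuous_on_norm_on[OF assms] continuous_on_subset by blast
  ultimately obtain u where u: "u \<in> ?S" "\<And>y. y \<in> ?S \<Longrightarrow> f u \<le> f y"
    using continuous_attains_inf[of ?S f] by blast
  have "f u \<noteq> 0" "0 \<le> f u"
    using norm_on_nonneg[OF f] norm_on_eq_0_iff[OF f] u(1) by auto
  then have pos: "0 < f u" by simp
  have "norm x \<le> (1 / f u) * f x" if x: "x \<in> V" for x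
  proof (cases "x = 0")
    case True
    then show ?thesis using norm_on_eq_0_iff[OF f x] by simp
  next
    case False
    have "f u \<le> f (x /\<^sub>R norm x)" using False x V by (intro u(2)) (simp add: subspace_scale)
    also have "\<dots> = \<bar>inverse (norm x)\<bar> * f x" by (rule norm_on_scaleR[OF f x])
    finally show ?thesis using pos False by (simp add: field_simps)
  qed
  with that[of "1 / f u"] pos show ?thesis by simp
qed

section \<open>Blocks and weighted distances\<close>

lemma subspace_strategy_space: "subspace (strategy_space G \<nu>)"
  by (auto simp: subspace_def strategy_space_def)

lemma block_in_strategy_space: "block G \<nu> x \<in> strategy_space G \<nu>"
  by (simp add: block_def strategy_space_def)

lemma block_diff: "block G \<nu> (x - y) = block G \<nu> x - block G \<nu> y"
  by (simp add: block_def vec_eq_iff)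

lemma continuous_on_block [continuous_intros]:
  assumes "continuous_on A f"
  shows "continuous_on A (\<lambda>x. block G \<nu> (f x))"
  unfolding block_def
proof (rule continuous_on_vec_lambda)
  fix j
  show "continuous_on A (\<lambda>x. if owner G j = \<nu> then f x $ j else 0)"
    using assms by (cases "owner G j = \<nu>") (auto intro!: continuous_intros)
qed

lemma continuous_on_deviate [continuous_intros]:
  assumes "continuous_on A f" "continuous_on A g"
  shows "continuous_on A (\<lambda>x. deviate G \<nu> (f x) (g x))"
  unfolding deviate_def
proof (rule continuous_on_vec_lambda)
  fix j
  show "continuous_on A (\<lambda>x. if owner G j = \<nu> then f x $ j else g x $ j)"
    using assms by (cases "owner G j = \<nu>") (auto intro!: continuous_intros)
qed

lemma sum_block: "(\<Sum>\<nu>\<in>UNIV. block G \<nu> x) = x" for G :: "('p::finite, 'n::finite) minep"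
  by (simp add: block_def vec_eq_iff)

lemma norm_on_block_nonneg:
  assumes "norm_on (strategy_space G \<nu>) f"
  shows "0 \<le> f (block G \<nu> x - block G \<nu> y)"
  by (intro norm_on_nonneg[OF assms] subspace_diff subspace_strategy_space block_in_strategy_space)

lemma continuous_on_block_norm:
  assumes "norm_on (strategy_space G \<nu>) f"
  shows "continuous_on A (\<lambda>y. f (block G \<nu> x - block G \<nu> y))"
proof (rule continuous_on_compose2[OF continuous_on_norm_on[OF assms subspace_strategy_space]])
  show "continuous_on A (\<lambda>y. block G \<nu> x - block G \<nu> y)" by (intro continuous_intros)
qed (auto intro: subspace_diff subspace_strategy_space block_in_strategy_space)

lemma wdist_le_iff: "wdist G nrm w x y \<le> r \<longleftrightarrow> (\<forall>\<nu>. w \<nu> * nrm \<nu> (block G \<nu> x - block G \<nu> y) \<le> r)"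
  unfolding wdist_def by (subst Max_le_iff) auto

lemma le_wdist: "w \<nu> * nrm \<nu> (block G \<nu> x - block G \<nu> y) \<le> wdist G nrm w x y"
  using wdist_le_iff by blast

lemma le_wsqrt_int: "w \<nu> * sqrt (real (nint G \<nu>)) \<le> wsqrt_int G w"
  unfolding wsqrt_int_def by (rule Max_ge) auto

section \<open>Closedness of the mixed-integer feasible sets\<close>

lemma closed_blockwise:
  assumes "\<And>\<nu>. closed (A \<nu>)"
  shows "closed {x. \<forall>\<nu>. block G \<nu> x \<in> A \<nu>}"
proof -
  have "closed (\<Inter>\<nu>. block G \<nu> -` A \<nu>)"
    using assms continuous_on_block[OF continuous_on_id, of UNIV G]
    by (intro closed_INT ballI closed_vimage) (auto simp: id_def)
  also have "(\<Inter>\<nu>. block G \<nu> -` A \<nu>) = {x. \<forall>\<nu>. block G \<nu> x \<in> A \<nu>}" by auto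
  finally show ?thesis .
qed

text \<open>The integers are closed in the reals, so each integrality constraint is the preimage of
  a closed set under a coordinate map.\<close>

lemma closed_mi_feas:
  fixes G :: "('p, 'n::finite) minep"
  assumes "closed (feas G \<nu>)"
  shows "closed (mi_feas G \<nu>)"
proof -
  have "mi_feas G \<nu> = feas G \<nu> \<inter>
      (\<Inter>j\<in>{j. owner G j = \<nu> \<and> pos G j \<in> {1..nint G \<nu>}}. (\<lambda>y. y $ j) -` \<int>)"
    unfolding mi_feas_def by blast
  moreover have "closed ((\<lambda>y::real ^ 'n. y $ j) -` \<int>)" for j
    by (intro closed_vimage closed_Ints continuous_intros)
  ultimately show ?thesis using assms by (metis (no_types, lifting) closed_INT closed_Int)
qed

section \<open>The contraction estimate\<close>

locale approx_contractive_minep =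
  fixes G :: "('p::finite, 'n::finite) minep"
    and nrm :: "'p \<Rightarrow> real ^ 'n \<Rightarrow> real"
    and \<alpha> \<beta> :: real and w :: "'p \<Rightarrow> real"
  assumes game: "is_minep G"
    and single_valued: "cont_single_valued G"
    and nrm: "norm_on (strategy_space G \<nu>) (nrm \<nu>)"
    and A: "assumption_A G nrm \<alpha> w"
    and B: "assumption_B G nrm \<beta>"
begin

definition C :: real where "C = 2 * \<beta> * wsqrt_int G w"

lemma \<alpha>: "0 \<le> \<alpha>" "\<alpha> < 1" and w_pos: "0 < w \<nu>" and \<beta>_pos: "0 < \<beta>"
  using A B by (auto simp: assumption_A_def assumption_B_def)

lemma wdist_nonneg: "0 \<le> wdist G nrm w x y"
proof -
  \<comment> \<open>Here \<open>undefined\<close> is merely some player; any player bounds the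
    maximum from below.\<close>
  have "0 \<le> w undefined * nrm undefined (block G undefined x - block G undefined y)"
    using w_pos[of undefined] norm_on_block_nonneg[OF nrm] by simp
  then show ?thesis using le_wdist order_trans by blast
qed

lemma mi_profiles_subset: "mi_profiles G \<subseteq> profiles G"
  by (auto simp: mi_profiles_def profiles_def mi_feas_def)

lemma closed_mi_profiles: "closed (mi_profiles G)"
  unfolding mi_profiles_def
  using game by (intro closed_blockwise closed_mi_feas) (auto simp: is_minep_def)

lemma feas_subset: "feas G \<nu> \<subseteq> strategy_space G \<nu>"
  using game by (auto simp: is_minep_def)

lemma mi_best_response_subset: "mi_best_response G \<nu> x \<subseteq> mi_feas G \<nu>"
  by (auto simp: mi_best_response_def is_arg_min_def)

lemma mi_feas_subset: "mi_feas G \<nu> \<subseteq> strategy_space G \<nu>"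
  using feas_subset by (auto simp: mi_feas_def)

text \<open>Single-valuedness on \<open>profiles G\<close> makes \<open>the_elem\<close> return an
  actual minimiser instead of an unspecified value.\<close>

lemma cont_br_in:
  assumes "x \<in> profiles G"
  shows "cont_br G \<nu> x \<in> strategy_space G \<nu>"
proof -
  have "is_singleton (cont_best_response G \<nu> x)"
    using single_valued assms by (simp add: cont_single_valued_def)
  then obtain y where "cont_best_response G \<nu> x = {y}" by (rule is_singletonE)
  then have "cont_br G \<nu> x \<in> feas G \<nu>"
    by (auto simp: cont_br_def cont_best_response_def is_arg_min_def)
  then show ?thesis using feas_subset by blast
qed

text \<open>Triangle inequality along \<open>y\<close>, \<open>cont_br G \<nu> x\<close>,
  \<open>cont_br G \<nu> z\<close>, \<open>block G \<nu> z\<close>. Assumption B controls the outer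
  legs, the last one because an equilibrium block is a best response to its own profile; Assumption
  A controls the middle leg.\<close>

lemma best_response_distance:
  assumes x: "x \<in> mi_profiles G" and y: "y \<in> mi_best_response G \<nu> x"
    and z: "z \<in> equilibria G"
  shows "w \<nu> * nrm \<nu> (y - block G \<nu> z) \<le> \<alpha> * wdist G nrm w x z + C"
proof -
  let ?n = "nrm \<nu>" and ?s = "\<beta> * sqrt (real (nint G \<nu>))"
  note V = subspace_strategy_space[of G \<nu>]
  have zm: "z \<in> mi_profiles G" and zb: "block G \<nu> z \<in> mi_best_response G \<nu> z"
    using z by (auto simp: equilibria_def)
  have px: "x \<in> profiles G" and pz: "z \<in> profiles G" using x zm mi_profiles_subset by auto
  note mem = cont_br_in[OF px, of \<nu>] cont_br_in[OF pz, of \<nu>] block_in_strategy_space[of G \<nu> z]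
  have yV: "y \<in> strategy_space G \<nu>" using y mi_best_response_subset mi_feas_subset by blast
  have 1: "?n (y - cont_br G \<nu> x) \<le> ?s"
    using B x y by (auto simp: assumption_B_def mi_profiles_def)
  have "?n (block G \<nu> z - cont_br G \<nu> z) \<le> ?s"
    using B zm zb by (auto simp: assumption_B_def mi_profiles_def)
  then have 2: "?n (cont_br G \<nu> z - block G \<nu> z) \<le> ?s"
    using norm_on_diff_commute[OF nrm V mem(2,3)] by simp
  have "w \<nu> * ?n (cont_br G \<nu> x - cont_br G \<nu> z) \<le>
      (MAX \<nu>. w \<nu> * nrm \<nu> (cont_br G \<nu> x - cont_br G \<nu> z))"
    by (rule Max_ge) auto
  also have "\<dots> \<le> \<alpha> * wdist G nrm w x z" using A px pz by (auto simp: assumption_A_def)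
  finally have 3: "w \<nu> * ?n (cont_br G \<nu> x - cont_br G \<nu> z) \<le> \<alpha> * wdist G nrm w x z" .
  have "?n (y - block G \<nu> z) \<le> ?n (y - cont_br G \<nu> x) + ?n (cont_br G \<nu> x - block G \<nu> z)"
    by (rule norm_on_triangle_diff[OF nrm V yV mem(1,3)])
  also have "?n (cont_br G \<nu> x - block G \<nu> z) \<le>
      ?n (cont_br G \<nu> x - cont_br G \<nu> z) + ?n (cont_br G \<nu> z - block G \<nu> z)"
    by (rule norm_on_triangle_diff[OF nrm V mem])
  finally have "?n (y - block G \<nu> z) \<le> 2 * ?s + ?n (cont_br G \<nu> x - cont_br G \<nu> z)"
    using 1 2 by linarith
  then have "w \<nu> * ?n (y - block G \<nu> z) \<le>
      w \<nu> * (2 * ?s + ?n (cont_br G \<nu> x - cont_br G \<nu> z))"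
    using w_pos[of \<nu>] by (intro mult_left_mono) auto
  also have "\<dots> = 2 * \<beta> * (w \<nu> * sqrt (real (nint G \<nu>))) +
      w \<nu> * ?n (cont_br G \<nu> x - cont_br G \<nu> z)"
    by (simp add: algebra_simps)
  also have "\<dots> \<le> C + \<alpha> * wdist G nrm w x z"
    unfolding C_def using 3 \<beta>_pos le_wsqrt_int[of w \<nu> G] by (intro add_mono mult_left_mono) auto
  finally show ?thesis by simp
qed

section \<open>Compactness of the set of equilibria\<close>

text \<open>The blocks of \<open>y\<close> are best responses to \<open>y\<close> itself, so the
  distance \<open>d\<close> satisfies \<open>d \<le> \<alpha> * d + C\<close>.\<close>

lemma equilibria_wdist_le:
  assumes "y \<in> equilibria G" "z \<in> equilibria G"
  shows "wdist G nrm w y z \<le> C / (1 - \<alpha>)"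
proof -
  have "wdist G nrm w y z \<le> \<alpha> * wdist G nrm w y z + C"
    unfolding wdist_le_iff[of G nrm w y z "\<alpha> * wdist G nrm w y z + C"]
    using assms best_response_distance by (auto simp: equilibria_def)
  then show ?thesis using \<alpha> by (simp add: field_simps)
qed

text \<open>A vector is the sum of its blocks, and each block is compared with its player's norm
  through \<open>norm_on_lower\<close>. This transfers bounds on the weighted distance to Euclidean
  boundedness.\<close>

lemma wdist_bound:
  obtains c where "c \<ge> 0" "\<And>y z. norm (y - z) \<le> c * wdist G nrm w y z"
proof -
  have "\<exists>m\<ge>0. \<forall>v\<in>strategy_space G \<nu>. norm v \<le> m * nrm \<nu> v" for \<nu>
    using norm_on_lower[OF nrm subspace_strategy_space, of \<nu>] by metis
  then obtain m where m: "\<And>\<nu>. m \<nu> \<ge> 0"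
    "\<And>\<nu> v. v \<in> strategy_space G \<nu> \<Longrightarrow> norm v \<le> m \<nu> * nrm \<nu> v" by metis
  have "norm (y - z) \<le> (\<Sum>\<nu>\<in>UNIV. m \<nu> / w \<nu>) * wdist G nrm w y z" for y z
  proof -
    have "norm (y - z) = norm (\<Sum>\<nu>\<in>UNIV. block G \<nu> (y - z))" by (simp add: sum_block)
    also have "\<dots> \<le> (\<Sum>\<nu>\<in>UNIV. norm (block G \<nu> (y - z)))" by (rule norm_sum)
    also have "\<dots> \<le> (\<Sum>\<nu>\<in>UNIV. m \<nu> / w \<nu> * wdist G nrm w y z)"
    proof (rule sum_mono)
      fix \<nu>
      have "norm (block G \<nu> (y - z)) \<le> m \<nu> * nrm \<nu> (block G \<nu> (y - z))"
        by (rule m(2)[OF block_in_strategy_space])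
      also have "\<dots> = m \<nu> / w \<nu> * (w \<nu> * nrm \<nu> (block G \<nu> y - block G \<nu> z))"
        using w_pos[of \<nu>] by (simp add: block_diff)
      also have "\<dots> \<le> m \<nu> / w \<nu> * wdist G nrm w y z"
        using m(1)[of \<nu>] w_pos[of \<nu>] by (intro mult_left_mono le_wdist) auto
      finally show "norm (block G \<nu> (y - z)) \<le> m \<nu> / w \<nu> * wdist G nrm w y z" .
    qed
    finally show ?thesis by (simp add: sum_distrib_right)
  qed
  moreover have "(\<Sum>\<nu>\<in>UNIV. m \<nu> / w \<nu>) \<ge> 0"
    using m(1) w_pos by (intro sum_nonneg) (simp add: less_imp_le)
  ultimately show ?thesis using that by blast
qed

lemma bounded_if_wdist_le:
  assumes "\<And>y. y \<in> S \<Longrightarrow> wdist G nrm w y z \<le> r"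
  shows "bounded S"
proof -
  obtain c where c: "c \<ge> 0" "\<And>y z. norm (y - z) \<le> c * wdist G nrm w y z"
    using wdist_bound by blast
  have "dist z y \<le> c * r" if "y \<in> S" for y
    using c(2)[of y z] mult_left_mono[OF assms[OF that] c(1)] by (simp add: dist_norm norm_minus_commute)
  then show ?thesis by (auto simp: bounded_def)
qed

text \<open>Optimality of a block is a family of non-strict inequalities between continuous
  functions of the profile. The competing strategies \<open>y\<close> range over a set independent
  of the profile, so the equilibria form an intersection of closed sets.\<close>

lemma closed_equilibria: "closed (equilibria G)"
proof -
  have cont: "continuous_on UNIV (cost G \<nu>)" for \<nu>
  proof -
    have "\<exists>g. continuous_on UNIV g \<and> (\<forall>y. GDERIV (cost G \<nu>) y :> g y)"
      using game by (simp add: is_minep_def)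
    then obtain g where "\<forall>y. GDERIV (cost G \<nu>) y :> g y" by (elim exE conjE)
    then show ?thesis
      by (intro continuous_at_imp_continuous_on ballI has_derivative_continuous)
        (auto simp: gderiv_def)
  qed
  have "continuous_on UNIV (\<lambda>x. cost G \<nu> (deviate G \<nu> y x))"
    "continuous_on UNIV (\<lambda>x. cost G \<nu> (deviate G \<nu> (block G \<nu> x) x))" for \<nu> y
    by (rule continuous_on_compose2[OF cont], auto intro!: continuous_intros)+
  then have "closed (mi_profiles G \<inter> (\<Inter>\<nu>. \<Inter>y\<in>mi_feas G \<nu>.
      {x. cost G \<nu> (deviate G \<nu> (block G \<nu> x) x) \<le> cost G \<nu> (deviate G \<nu> y x)}))"
    by (intro closed_Int closed_mi_profiles closed_INT ballI closed_Collect_le)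
  also have "(mi_profiles G \<inter> (\<Inter>\<nu>. \<Inter>y\<in>mi_feas G \<nu>.
      {x. cost G \<nu> (deviate G \<nu> (block G \<nu> x) x) \<le> cost G \<nu> (deviate G \<nu> y x)})) = equilibria G"
    by (auto simp: equilibria_def mi_best_response_def is_arg_min_linorder mi_profiles_def)
  finally show ?thesis .
qed

lemma compact_equilibria: "compact (equilibria G)"
proof (cases "equilibria G = {}")
  case False
  then obtain z where "z \<in> equilibria G" by blast
  then have "bounded (equilibria G)" using equilibria_wdist_le by (intro bounded_if_wdist_le)
  then show ?thesis using closed_equilibria by (simp add: compact_eq_bounded_closed)
qed simp

text \<open>The maximum over the equilibria is attained, so that \<open>GREATEST\<close> is not a junk value.\<close>

lemma wdist_le_Greatest:
  assumes z: "z \<in> equilibria G"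
  shows "wdist G nrm w x0 z \<le>
    (GREATEST r. \<exists>z\<in>equilibria G. \<exists>\<nu>. r = w \<nu> * nrm \<nu> (block G \<nu> x0 - block G \<nu> z))"
proof -
  let ?f = "\<lambda>\<nu> z. w \<nu> * nrm \<nu> (block G \<nu> x0 - block G \<nu> z)"
  let ?U = "\<Union>\<nu>. ?f \<nu> ` equilibria G"
  \<comment> \<open>For each player the distances form a compact set of reals; a union over finitely
    many players is compact and so has a largest element.\<close>
  have "compact (?f \<nu> ` equilibria G)" for \<nu>
    by (rule compact_continuous_image[OF _ compact_equilibria])
      (intro continuous_on_mult_left continuous_on_block_norm nrm)
  then have "compact ?U" by (intro compact_UN finite)
  moreover have "?U \<noteq> {}" using z by blast
  ultimately have "\<exists>s\<in>?U. \<forall>t\<in>?U. t \<le> s" by (rule compact_attains_sup)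
  then obtain s where s: "s \<in> ?U" "\<forall>t\<in>?U. t \<le> s" by (elim bexE)
  have ge: "?f \<nu> y \<le> s" if "y \<in> equilibria G" for \<nu> y
    using s(2) that by fast
  have "(GREATEST r. \<exists>z\<in>equilibria G. \<exists>\<nu>. r = ?f \<nu> z) = s"
  proof (rule Greatest_equality)
    show "\<exists>z\<in>equilibria G. \<exists>\<nu>. s = ?f \<nu> z" using s(1) by fast
    show "r \<le> s" if "\<exists>z\<in>equilibria G. \<exists>\<nu>. r = ?f \<nu> z" for r
      using that ge by fast
  qed
  then show ?thesis using ge[OF z] by (simp add: wdist_le_iff)
qed

end

section \<open>Iterates of the best-response method\<close>

text \<open>The type variables of the imported locale are renamed here: \<open>'a\<close> indexes
  players and \<open>'b\<close> coordinates.\<close>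

locale jacobi_minep = approx_contractive_minep +
  fixes J :: "nat \<Rightarrow> 'a set" and x :: "nat \<Rightarrow> real ^ 'b" and h :: nat
  assumes jacobi: "jacobi_sequence G J x"
    and h_pos: "1 \<le> h"
    and update: "\<nu> \<in> (\<Union>t\<in>{k..k + h - 1}. J t)"
begin

lemma block_Suc:
  "\<nu> \<in> J k \<Longrightarrow> block G \<nu> (x (Suc k)) \<in> mi_best_response G \<nu> (x k)"
  "\<nu> \<notin> J k \<Longrightarrow> block G \<nu> (x (Suc k)) = block G \<nu> (x k)"
  using jacobi by (auto simp: jacobi_sequence_def)

lemma iterate_in_mi_profiles: "x k \<in> mi_profiles G"
proof (induction k)
  case 0
  then show ?case using jacobi by (simp add: jacobi_sequence_def)
next
  case (Suc k)
  have "block G \<nu> (x (Suc k)) \<in> mi_feas G \<nu>" for \<nu>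
    using Suc block_Suc[of \<nu> k] mi_best_response_subset
    by (cases "\<nu> \<in> J k") (auto simp: mi_profiles_def)
  then show ?case by (simp add: mi_profiles_def)
qed

text \<open>The index \<open>m\<close> counts completed rounds of \<open>h\<close> iterations. Any
  nonincreasing \<open>E\<close> that dominates the initial distance and absorbs one application of
  the affine map per round bounds the distance. Leaving \<open>E\<close> abstract serves both the
  iteration bound and the cluster point estimate.\<close>

lemma wdist_majorant:
  assumes z: "z \<in> equilibria G"
    and E0: "wdist G nrm w (x 0) z \<le> E 0"
    and step: "\<And>m. \<alpha> * E m + C \<le> E (Suc m)"
    and decr: "\<And>m. E (Suc m) \<le> E m"
    and k: "m * h \<le> k"
  shows "wdist G nrm w (x k) z \<le> E m"
  using k
proof (induction m arbitrary: k)
  case 0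
  have "wdist G nrm w (x k) z \<le> E 0"
  \<comment> \<open>Before any round is complete, an updated block is within \<open>E 1\<close>,
    hence within \<open>E 0\<close>, and the others keep their bound.\<close>
  proof (induction k)
    case (Suc k)
    have "w \<nu> * nrm \<nu> (block G \<nu> (x (Suc k)) - block G \<nu> z) \<le> E 0" for \<nu>
    proof (cases "\<nu> \<in> J k")
      case True
      have "w \<nu> * nrm \<nu> (block G \<nu> (x (Suc k)) - block G \<nu> z) \<le> \<alpha> * wdist G nrm w (x k) z + C"
        using best_response_distance[OF iterate_in_mi_profiles block_Suc(1)[OF True] z] .
      also have "\<dots> \<le> \<alpha> * E 0 + C" using Suc \<alpha> by (simp add: mult_left_mono)
      finally show ?thesis using step[of 0] decr[of 0] by linarith
    next
      case False
      then show ?thesis using Suc block_Suc(2) by (simp add: wdist_le_iff)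
    qed
    then show ?case by (simp add: wdist_le_iff)
  qed (rule E0)
  then show ?case .
next
  case (Suc m)
  \<comment> \<open>A block updated at iteration \<open>t\<close> or later never leaves the new
    bound: at each further iteration it is kept, or recomputed from a profile still within
    \<open>E m\<close>. The update made in iteration \<open>t\<close> first shows in
    \<open>x (Suc t)\<close>.\<close>
  have updated: "w \<nu> * nrm \<nu> (block G \<nu> (x (Suc t + d)) - block G \<nu> z) \<le> E (Suc m)"
    if "m * h \<le> t" "\<nu> \<in> J t" for \<nu> t d
  proof -
    have new: "w \<nu> * nrm \<nu> (block G \<nu> (x (Suc s)) - block G \<nu> z) \<le> E (Suc m)"
      if "m * h \<le> s" "\<nu> \<in> J s" for s
    proof -
      have "w \<nu> * nrm \<nu> (block G \<nu> (x (Suc s)) - block G \<nu> z) \<le> \<alpha> * wdist G nrm w (x s) z + C"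
        using best_response_distance[OF iterate_in_mi_profiles block_Suc(1)[OF that(2)] z] .
      also have "\<dots> \<le> \<alpha> * E m + C" using Suc.IH[OF that(1)] \<alpha> by (simp add: mult_left_mono)
      finally show ?thesis using step[of m] by linarith
    qed
    show ?thesis
    proof (induction d)
      case 0
      then show ?case using new[OF that] by simp
    next
      case (Suc d)
      then show ?case
        using new[of "Suc t + d"] block_Suc(2)[of \<nu> "Suc t + d"] that(1)
        by (cases "\<nu> \<in> J (Suc t + d)") auto
    qed
  qed
  have "w \<nu> * nrm \<nu> (block G \<nu> (x k) - block G \<nu> z) \<le> E (Suc m)" for \<nu>
  proof -
    \<comment> \<open>The last index of the window is \<open>m * h + h - 1\<close>, so
      \<open>Suc t \<le> Suc m * h \<le> k\<close>, and the case \<open>\<not> Suc t \<le> k\<close>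
      below is contradictory.\<close>
    obtain t where t: "t \<in> {m * h..m * h + h - 1}" "\<nu> \<in> J t"
      using update[of \<nu> "m * h"] by blast
    show ?thesis
    proof (cases "Suc t \<le> k")
      case True
      then show ?thesis using updated[of t \<nu> "k - Suc t"] t by simp
    next
      case False
      then show ?thesis using t(1) Suc.prems h_pos by auto
    qed
  qed
  then show ?case by (simp add: wdist_le_iff)
qed

end

section \<open>Iteration bound and location of cluster points\<close>

theorem theorem1:
  fixes G :: "('p::finite, 'n::finite) minep"
    and nrm :: "'p \<Rightarrow> real ^ 'n \<Rightarrow> real"
    and \<alpha> \<beta> :: real and w :: "'p \<Rightarrow> real"
    and J :: "nat \<Rightarrow> 'p set" and x :: "nat \<Rightarrow> real ^ 'n" and h :: nat
  assumes "is_minep G"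
    and "cont_single_valued G"
    and "\<forall>\<nu>. norm_on (strategy_space G \<nu>) (nrm \<nu>)"
    and "assumption_A G nrm \<alpha> w"
    and "assumption_B G nrm \<beta>"
    and "(MAX \<nu>. sqrt (real (nint G \<nu>))) > 0"
    and "jacobi_sequence G J x"
    and "h \<ge> 1"
    and "\<forall>\<nu> k. \<nu> \<in> (\<Union>t\<in>{k..k + h - 1}. J t)"
  shows
    "(\<forall>\<gamma>. 1 < \<gamma> \<and> (\<alpha> = 0 \<or> \<gamma> < 1 / \<alpha>) \<longrightarrow> (\<forall>xs\<in>equilibria G.
        \<exists>k. int k \<le> kbar G nrm \<alpha> w \<beta> h (x 0) \<gamma> \<and>
          wdist G nrm w (x k) xs < 2 * \<beta> * (\<gamma> / (1 - \<gamma> * \<alpha>)) * wsqrt_int G w)) \<and>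
     (\<forall>\<gamma>. 1 < \<gamma> \<and> (\<alpha> = 0 \<or> \<gamma> < 1 / \<alpha>) \<longrightarrow> (\<forall>xs\<in>equilibria G.
        \<forall>k. int k \<ge> kbar G nrm \<alpha> w \<beta> h (x 0) \<gamma> \<longrightarrow>
          wdist G nrm w (x k) xs < 2 * \<beta> * (\<gamma> / (1 - \<gamma> * \<alpha>)) * wsqrt_int G w)) \<and>
     (bounded (mi_profiles G) \<or> equilibria G \<noteq> {} \<longrightarrow>
        (\<exists>xt. cluster_point x xt) \<and>
        (\<forall>xt. cluster_point x xt \<longrightarrow>
           xt \<in> mi_profiles G \<and>
           (\<forall>xs\<in>equilibria G.
              wdist G nrm w xt xs \<le> 2 * \<beta> * (1 / (1 - \<alpha>)) * wsqrt_int G w)))"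
proof -
  interpret jacobi_minep G nrm \<alpha> \<beta> w J x h
    using assms by unfold_locales auto
  \<comment> \<open>A player with an integer variable makes \<open>C\<close> positive, so that
    dividing by it in \<open>kbar\<close> is meaningful and the estimate can be strict.\<close>
  obtain \<nu>0 where "sqrt (real (nint G \<nu>0)) > 0"
    using assms(6) by (auto simp: Max_gr_iff)
  then have "0 < w \<nu>0 * sqrt (real (nint G \<nu>0))" using w_pos by simp
  then have "0 < wsqrt_int G w" using le_wsqrt_int less_le_trans by blast
  then have C_pos: "0 < C" using \<beta>_pos by (simp add: C_def)
  define D where "D = (GREATEST r. \<exists>z\<in>equilibria G. \<exists>\<nu>. r = w \<nu> * nrm \<nu> (block G \<nu> (x 0) - block G \<nu> z))"
  have D: "wdist G nrm w (x 0) z \<le> D" if "z \<in> equilibria G" for z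
    unfolding D_def by (rule wdist_le_Greatest[OF that])

  \<comment> \<open>Nonnegativity of \<open>kbar\<close> is included so that it can itself serve as
    the iteration index in (i).\<close>
  have eventual: "0 \<le> kbar G nrm \<alpha> w \<beta> h (x 0) \<gamma> \<and>
      (\<forall>k. int k \<ge> kbar G nrm \<alpha> w \<beta> h (x 0) \<gamma> \<longrightarrow>
        wdist G nrm w (x k) xs < 2 * \<beta> * (\<gamma> / (1 - \<gamma> * \<alpha>)) * wsqrt_int G w)"
    if \<gamma>: "1 < \<gamma>" "\<alpha> = 0 \<or> \<gamma> < 1 / \<alpha>" and xs: "xs \<in> equilibria G" for \<gamma> xs
  proof -
    \<comment> \<open>The case \<open>\<alpha> = 0\<close> is separate because
      \<open>1 / 0 = 0\<close> in HOL, whereas the convention is infinity.\<close>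
    have ga: "\<gamma> * \<alpha> < 1" using \<gamma> \<alpha> by (cases "\<alpha> = 0") (auto simp: field_simps)
    \<comment> \<open>The level \<open>K\<close> is chosen so that the affine map sends
      \<open>\<gamma> * K\<close> exactly to \<open>K\<close>.\<close>
    define K where "K = C / (1 - \<gamma> * \<alpha>)"
    have K: "0 < K" using C_pos ga by (simp add: K_def)
    have "C = (1 - \<gamma> * \<alpha>) * K" using ga by (simp add: K_def)
    then have CK: "C = K - \<gamma> * \<alpha> * K" by (simp add: left_diff_distrib)
    \<comment> \<open>This is the argument of the logarithm in \<open>kbar\<close>; the maximum with
      \<open>\<gamma>\<close> keeps the logarithm nonnegative.\<close>
    define q where "q = max (D / K) \<gamma>"
    define M where "M = \<lceil>log \<gamma> q\<rceil>"
    have kbar: "kbar G nrm \<alpha> w \<beta> h (x 0) \<gamma> = int h * M"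
      by (simp add: kbar_def M_def q_def K_def C_def D_def mult.commute)
    have q: "\<gamma> \<le> q" "D \<le> q * K" using K by (auto simp: q_def max_def field_simps)
    have "0 \<le> log \<gamma> q" using q(1) \<gamma>(1) by simp
    then have M0: "0 \<le> M" by (simp add: M_def)
    have "log \<gamma> q \<le> real (nat M)" using M0 by (simp add: M_def)
    then have "q \<le> \<gamma> ^ nat M"
      using q(1) \<gamma>(1) by (simp add: log_le_iff powr_realpow)
    then have "D \<le> \<gamma> ^ nat M * K"
      using q(2) K mult_right_mono[of q "\<gamma> ^ nat M" K] by linarith
    define E where "E m = max (D / \<gamma> ^ m) K" for m
    \<comment> \<open>The ceiling makes \<open>M\<close> large enough for
      \<open>D / \<gamma> ^ M\<close> to have dropped to \<open>K\<close>.\<close>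
    have EM: "E (nat M) \<le> K"
      using \<open>D \<le> \<gamma> ^ nat M * K\<close> \<gamma>(1) by (simp add: E_def field_simps)
    have D0: "0 \<le> D" using D[OF xs] wdist_nonneg[of "x 0" xs] by linarith
    have step: "\<alpha> * E m + C \<le> E (Suc m)" for m
    \<comment> \<open>From \<open>\<gamma> * K\<close> upwards the affine map shrinks the bound by
      at least the factor \<open>\<gamma>\<close>; below that level it lands at or under
      \<open>K\<close>.\<close>
    proof (cases "\<gamma> * K \<le> E m")
      case True
      then have Em: "E m = D / \<gamma> ^ m"
        using \<gamma>(1) K mult_strict_right_mono[of 1 \<gamma> K] by (auto simp: E_def max_def split: if_splits)
      have "C = (1 - \<gamma> * \<alpha>) * K" by (simp add: CK algebra_simps)
      also have "\<dots> \<le> (1 - \<gamma> * \<alpha>) * (E m / \<gamma>)"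
        using True \<gamma>(1) ga by (intro mult_left_mono) (auto simp: field_simps)
      also have "\<dots> = E m / \<gamma> - \<alpha> * E m" using \<gamma>(1) by (simp add: field_simps)
      finally have "\<alpha> * E m + C \<le> E m / \<gamma>" by simp
      also have "\<dots> \<le> E (Suc m)" unfolding Em by (simp add: E_def mult.commute)
      finally show ?thesis .
    next
      case False
      then have "\<alpha> * E m \<le> \<alpha> * (\<gamma> * K)" using \<alpha> by (intro mult_left_mono) auto
      then have "\<alpha> * E m + C \<le> K" by (simp add: CK algebra_simps)
      then show ?thesis by (simp add: E_def)
    qed
    have decr: "E (Suc m) \<le> E m" for m
    proof -
      have "D / \<gamma> ^ Suc m \<le> D / \<gamma> ^ m"
        using D0 \<gamma>(1) by (intro divide_left_mono power_increasing) auto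
      then show ?thesis unfolding E_def by (intro max.mono) auto
    qed
    have "wdist G nrm w (x k) xs < \<gamma> * K" if k: "int h * M \<le> int k" for k
    proof -
      have "int (nat M * h) \<le> int k" using k M0 by (simp add: mult.commute)
      then have "nat M * h \<le> k" by linarith
      moreover have "wdist G nrm w (x 0) xs \<le> E 0" using D[OF xs] by (simp add: E_def)
      ultimately have "wdist G nrm w (x k) xs \<le> E (nat M)"
        using wdist_majorant[where E = E, OF xs _ step decr] by simp
      \<comment> \<open>Strictness comes from the gap between \<open>K\<close> and
        \<open>\<gamma> * K\<close>.\<close>
      also have "\<dots> < \<gamma> * K" using EM K \<gamma>(1) mult_strict_right_mono[of 1 \<gamma> K] by linarith
      finally show ?thesis .
    qed
    moreover have "\<gamma> * K = 2 * \<beta> * (\<gamma> / (1 - \<gamma> * \<alpha>)) * wsqrt_int G w"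
      by (simp add: K_def C_def)
    ultimately show ?thesis using M0 by (simp add: kbar)
  qed

  have first: "\<exists>k. int k \<le> kbar G nrm \<alpha> w \<beta> h (x 0) \<gamma> \<and>
      wdist G nrm w (x k) xs < 2 * \<beta> * (\<gamma> / (1 - \<gamma> * \<alpha>)) * wsqrt_int G w"
    if "1 < \<gamma>" "\<alpha> = 0 \<or> \<gamma> < 1 / \<alpha>" "xs \<in> equilibria G" for \<gamma> xs
    using eventual[OF that] by (intro exI[of _ "nat (kbar G nrm \<alpha> w \<beta> h (x 0) \<gamma>)"]) auto

  have majorant: "wdist G nrm w (x k) xs \<le> C / (1 - \<alpha>) + \<alpha> ^ m * wdist G nrm w (x 0) xs"
    if xs: "xs \<in> equilibria G" and k: "m * h \<le> k" for xs m k
  \<comment> \<open>These are the exact iterates of the affine map, raised by its fixed point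
    \<open>C / (1 - \<alpha>)\<close>; adding the fixed point makes them nonincreasing from any
    starting distance.\<close>
  proof (rule wdist_majorant[where E = "\<lambda>m. C / (1 - \<alpha>) + \<alpha> ^ m * wdist G nrm w (x 0) xs",
        OF xs _ _ _ k])
    have fixpoint: "\<alpha> * (C / (1 - \<alpha>)) + C = C / (1 - \<alpha>)" using \<alpha> by (simp add: field_simps)
    show "wdist G nrm w (x 0) xs \<le> C / (1 - \<alpha>) + \<alpha> ^ 0 * wdist G nrm w (x 0) xs"
      using C_pos \<alpha> by simp
    show "\<alpha> * (C / (1 - \<alpha>) + \<alpha> ^ m * wdist G nrm w (x 0) xs) + C
        \<le> C / (1 - \<alpha>) + \<alpha> ^ Suc m * wdist G nrm w (x 0) xs" for m
      using fixpoint by (simp add: distrib_left mult.assoc)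
    show "C / (1 - \<alpha>) + \<alpha> ^ Suc m * wdist G nrm w (x 0) xs
        \<le> C / (1 - \<alpha>) + \<alpha> ^ m * wdist G nrm w (x 0) xs" for m
      using \<alpha> wdist_nonneg by (intro add_left_mono mult_right_mono power_decreasing) auto
  qed

  have cluster: "\<exists>xt. cluster_point x xt" if "bounded (mi_profiles G) \<or> equilibria G \<noteq> {}"
  proof -
    have "bounded (range x)"
    proof (cases "equilibria G = {}")
      case True
      then show ?thesis
        using that iterate_in_mi_profiles bounded_subset[of "mi_profiles G" "range x"] by blast
    next
      case False
      then obtain z where "z \<in> equilibria G" by blast
      \<comment> \<open>Taking \<open>m = 0\<close> in the majorant bounds all iterates at
        once.\<close>
      then have "wdist G nrm w y z \<le> C / (1 - \<alpha>) + wdist G nrm w (x 0) z" if "y \<in> range x" for y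
        using majorant[of z 0] that by auto
      then show ?thesis by (rule bounded_if_wdist_le)
    qed
    then show ?thesis
      unfolding cluster_point_def using bounded_imp_convergent_subsequence by blast
  qed

  have cluster_in: "xt \<in> mi_profiles G" if xt: "cluster_point x xt" for xt
  proof -
    obtain r :: "nat \<Rightarrow> nat" where "(x \<circ> r) \<longlonglongrightarrow> xt"
      using xt unfolding cluster_point_def by blast
    then show ?thesis
      by (rule closed_sequentially[OF closed_mi_profiles, rotated]) (simp add: iterate_in_mi_profiles)
  qed

  have cluster_bound: "wdist G nrm w xt xs \<le> 2 * \<beta> * (1 / (1 - \<alpha>)) * wsqrt_int G w"
    if xt: "cluster_point x xt" and xs: "xs \<in> equilibria G" for xt xs
  proof -
    obtain r where r: "strict_mono r" "(x \<circ> r) \<longlonglongrightarrow> xt"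
      using xt unfolding cluster_point_def by blast
    have "w \<nu> * nrm \<nu> (block G \<nu> xt - block G \<nu> xs) \<le> C / (1 - \<alpha>)" for \<nu>
    proof (rule LIMSEQ_le)
      let ?f = "\<lambda>y. w \<nu> * nrm \<nu> (block G \<nu> xs - block G \<nu> y)"
      \<comment> \<open>Continuity was established in the second argument, so the difference is
        reversed first.\<close>
      have comm: "?f y = w \<nu> * nrm \<nu> (block G \<nu> y - block G \<nu> xs)" for y
        using norm_on_diff_commute[OF nrm subspace_strategy_space] block_in_strategy_space by metis
      have "continuous_on UNIV ?f"
        by (intro continuous_on_mult_left continuous_on_block_norm nrm)
      \<comment> \<open>The subsequence is thinned to the indices \<open>r (m * h)\<close>. As
        \<open>r\<close> is strictly increasing, \<open>m * h \<le> r (m * h)\<close>, so at least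
        \<open>m\<close> rounds are complete there and the term with \<open>\<alpha> ^ m\<close>
        vanishes in the limit.\<close>
      then have "(\<lambda>k. ?f ((x \<circ> r) (k * h))) \<longlonglongrightarrow> ?f xt"
        using LIMSEQ_subseq_LIMSEQ[OF r(2), of "\<lambda>k. k * h"] h_pos
        by (intro continuous_on_tendsto_compose[of UNIV ?f]) (auto simp: strict_mono_def o_def)
      then show "(\<lambda>k. w \<nu> * nrm \<nu> (block G \<nu> (x (r (k * h))) - block G \<nu> xs))
          \<longlonglongrightarrow> w \<nu> * nrm \<nu> (block G \<nu> xt - block G \<nu> xs)"
        by (simp add: comm)
      have "(\<lambda>m. \<alpha> ^ m) \<longlonglongrightarrow> 0" using \<alpha> by (intro LIMSEQ_realpow_zero) auto
      then show "(\<lambda>m. C / (1 - \<alpha>) + \<alpha> ^ m * wdist G nrm w (x 0) xs) \<longlonglongrightarrow> C / (1 - \<alpha>)"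
        using tendsto_add[OF tendsto_const tendsto_mult_left_zero] by fastforce
      have "w \<nu> * nrm \<nu> (block G \<nu> (x (r (m * h))) - block G \<nu> xs)
          \<le> C / (1 - \<alpha>) + \<alpha> ^ m * wdist G nrm w (x 0) xs" for m
        using majorant[OF xs seq_suble[OF r(1), of "m * h"]] le_wdist order_trans by blast
      then show "\<exists>N. \<forall>m\<ge>N. w \<nu> * nrm \<nu> (block G \<nu> (x (r (m * h))) - block G \<nu> xs)
          \<le> C / (1 - \<alpha>) + \<alpha> ^ m * wdist G nrm w (x 0) xs" by blast
    qed
    then show ?thesis by (simp add: wdist_le_iff C_def)
  qed

  show ?thesis
    by (intro conjI allI impI ballI)
      (use first eventual cluster cluster_in cluster_bound in \<open>simp_all\<close>)
qed

end
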